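(* Let $(X,d)$ be a locally compact metric space, let $S\subset X$ be a closed subset, let $D\ge 1$ be a real number, and let $\rho:S\times S\to[0,\infty)$ be an ultrametric on $S$ satisfying \[ d(x,y)\le \rho(x,y)\le D\cdot d(x,y)\quad\text{for every } x,y\in S.\] Then there exists an ultrametric $\bar\rho:X\times X\to[0,\infty)$ extending $\rho$ such that \[ \bar\rho(x,y)=\rho(x,y)\quad \forall x,y\in S;\] \[ \frac{2D}{2(D+1)}\cdot d(x,y)\le \bar\rho(x,y)\quad \forall x,y\in X;\] \[ \frac{2D}{2D+1}\cdot d(x,y)\le \bar\rho(x,y)\le 2D\cdot d(x,y)\quad \forall x\in S,\ y\in X.\] In particular, $\bar\rho$ is a $(2D+1)$-approximation of $d$ on pairs from $S\times X$.
   Context: An ultrametric on a set $X$ is a metric $\rho:X\times X\to[0,\infty)$ satisfying $\rho(x,z)\le\max\{\rho(x,y),\rho(y,z)\}$ for all $x,y,z\in X$. For a real number $A$, an ultrametric $\bar\rho$ on $X$ is said to $A$-approximate the metric $d$ (to be an $A$-approximation of $d$) on pairs from $S\times X$ if there exists a scaling factor $c>0$ such that $d(x,y)\le c\cdot\bar\rho(x,y)\le A\cdot d(x,y)$ for all $x\in S$ and $y\in X$. *)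

theory Defs
  imports "HOL-Analysis.Analysis"
begin

text \<open>As in \<^locale>\<open>Metric_space\<close>, a metric on a carrier set is a function on the whole type;
  its values off the carrier are irrelevant, except that the library locale normalizes them
  to be nonnegative and symmetric.\<close>

locale Ultrametric_space = Metric_space +
  assumes ultra_triangle:
    "\<lbrakk>x \<in> M; y \<in> M; z \<in> M\<rbrakk> \<Longrightarrow> d x z \<le> max (d x y) (d y z)"

definition ultrametric_approximates ::
    "real \<Rightarrow> ('a \<Rightarrow> 'a \<Rightarrow> real) \<Rightarrow> ('a \<Rightarrow> 'a \<Rightarrow> real) \<Rightarrow> 'a set \<Rightarrow> 'a set \<Rightarrow> bool" where
  "ultrametric_approximates A \<rho> d S X \<longleftrightarrow>
     Ultrametric_space X \<rho> \<and>
     (\<exists>c>0. \<forall>x\<in>S. \<forall>y\<in>X. d x y \<le> c * \<rho> x y \<and> c * \<rho> x y \<le> A * d x y)"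

end

theory Submission
  imports Defs
begin

text \<open>
  Suppose that \<open>S\<close> is nonempty. Every two points \<open>y, z\<close> of \<open>X\<close> are joined by chains
  \<open>y, p, q, z\<close> through \<open>p, q \<in> S\<close>. Let the cost of a chain be the largest of its three steps,
  where the inner step is measured by \<open>\<rho>\<close> and each outer step by \<open>2 * D * d\<close>, and let the
  extension be the infimum of the costs, off the diagonal. Routing \<open>y\<close> through one chosen, only
  nearly nearest, point of \<open>S\<close> would spoil the sharp constants; the infimum over all chains
  keeps them.

  The factor \<open>2 * D\<close> is what makes chains composable: a detour \<open>q, z, q'\<close> from \<open>S\<close> through \<open>z\<close>
  back to \<open>S\<close> satisfies \<open>\<rho> q q' \<le> D * (d q z + d z q') \<le> max (2 * D * d q z) (2 * D * d z q')\<close>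
  (lemma \<open>rho_detour\<close>). So in the concatenation of two chains
  \<open>y, p, q, z\<close> and \<open>z, q', r, w\<close>, the detour can be replaced by a direct step in \<open>S\<close>, and the
  ultrametric inequality for \<open>\<rho>\<close> collapses everything to the chain \<open>y, p, r, w\<close>
  without raising the cost (\<open>cost_concat\<close>). The same estimate with \<open>z \<in> S\<close> shows
  that chains between points of \<open>S\<close> cannot undercut \<open>\<rho>\<close>.

  The lower bounds hold for each single chain of cost \<open>m\<close>: the triangle inequality for \<open>d\<close>
  gives \<open>d y z \<le> m / (2 * D) + m + m / (2 * D)\<close>, and one of the outer terms disappears if \<open>y \<in> S\<close>,
  because then \<open>\<rho> y q \<le> m\<close> (\<open>rho_le_cost\<close>). The upper bound for \<open>y \<in> S\<close> is the cost of the
  chain \<open>y, y, y, z\<close>.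

  If \<open>S\<close> is empty, the construction is applied to a one-point set instead.
\<close>

locale ultrametric_extension =
  amb: Metric_space X d + sub: Ultrametric_space S \<rho>
  for X S :: "'a set" and d \<rho> :: "'a \<Rightarrow> 'a \<Rightarrow> real" +
  fixes D :: real
  assumes D_ge_1: "D \<ge> 1"
    and S_subset: "S \<subseteq> X"
    and S_nonempty: "S \<noteq> {}"
    and d_le_rho: "\<lbrakk>x \<in> S; y \<in> S\<rbrakk> \<Longrightarrow> d x y \<le> \<rho> x y"
    and rho_le_d: "\<lbrakk>x \<in> S; y \<in> S\<rbrakk> \<Longrightarrow> \<rho> x y \<le> D * d x y"
begin

definition cost :: "'a \<Rightarrow> 'a \<Rightarrow> 'a \<times> 'a \<Rightarrow> real" where
  "cost y z = (\<lambda>(p, q). max (2 * D * d y p) (max (\<rho> p q) (2 * D * d q z)))"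

definition ext :: "'a \<Rightarrow> 'a \<Rightarrow> real" where
  "ext y z = (if y = z then 0 else INF pq\<in>S \<times> S. cost y z pq)"

lemma cost_nonneg: "0 \<le> cost y z pq"
  by (cases pq) (simp add: cost_def le_max_iff_disj)

lemma cost_bounds:
  "2 * D * d y p \<le> cost y z (p, q)" "\<rho> p q \<le> cost y z (p, q)" "2 * D * d q z \<le> cost y z (p, q)"
  by (simp_all add: cost_def)

lemma ext_le_cost:
  assumes "y \<noteq> z" "p \<in> S" "q \<in> S"
  shows "ext y z \<le> cost y z (p, q)"
proof -
  have "bdd_below (cost y z ` (S \<times> S))"
    by (rule bdd_belowI2) (rule cost_nonneg)
  then show ?thesis
    using assms by (auto simp: ext_def intro: cINF_lower)
qed

lemma le_extI:
  assumes "y \<noteq> z" "\<And>p q. \<lbrakk>p \<in> S; q \<in> S\<rbrakk> \<Longrightarrow> c \<le> cost y z (p, q)"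
  shows "c \<le> ext y z"
  using assms S_nonempty by (auto simp: ext_def intro!: cINF_greatest)

lemma cost_near_ext:
  assumes "y \<noteq> z" "ext y z < c"
  obtains p q where "p \<in> S" "q \<in> S" "cost y z (p, q) < c"
  using le_extI[of y z c] assms by (meson linorder_not_less)

text \<open>The reason for the factor \<open>2 * D\<close> on outer steps: \<open>D\<close> pays for the distortion of \<open>\<rho>\<close>, and
  \<open>2\<close> for bounding the sum of two distances by their maximum.\<close>

lemma rho_detour:
  assumes "p \<in> S" "q \<in> S" "z \<in> X"
  shows "\<rho> p q \<le> max (2 * D * d p z) (2 * D * d z q)"
proof -
  have "d p q \<le> d p z + d z q"
    using assms S_subset by (intro amb.triangle) auto
  also have "\<dots> \<le> 2 * max (d p z) (d z q)"
    by simp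
  finally have "D * d p q \<le> D * (2 * max (d p z) (d z q))"
    using D_ge_1 by (intro mult_left_mono) auto
  also have "\<dots> = max (2 * D * d p z) (2 * D * d z q)"
    using D_ge_1 by (auto simp: max_def)
  finally show ?thesis
    using rho_le_d[OF assms(1,2)] by linarith
qed

lemma rho_le_outer:
  assumes "p \<in> S" "q \<in> S"
  shows "\<rho> p q \<le> 2 * D * d p q"
  using rho_detour[of p q q] assms S_subset D_ge_1 by auto

text \<open>This sharpens the lower bound for a starting point in \<open>S\<close>: the first two steps together
  count only once.\<close>

lemma rho_le_cost:
  assumes "x \<in> S" "p \<in> S" "q \<in> S"
  shows "\<rho> x q \<le> cost x z (p, q)"
  using sub.ultra_triangle[OF assms] rho_le_outer[OF assms(1,2)] cost_bounds(1,2)[of x p z q]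
    cost_bounds(2)[of p q x z] by linarith

text \<open>Behind the ultrametric inequality for the extension: replacing the detour through \<open>z\<close> by a
  step within \<open>S\<close>, and merging all steps within \<open>S\<close> into one, does not raise the cost.\<close>

lemma cost_concat:
  assumes "p \<in> S" "q \<in> S" "q' \<in> S" "r \<in> S" "z \<in> X"
  shows "cost y w (p, r) \<le> max (cost y z (p, q)) (cost z w (q', r))"
proof -
  let ?m = "max (cost y z (p, q)) (cost z w (q', r))"
  have "\<rho> q q' \<le> max (2 * D * d q z) (2 * D * d z q')"
    using assms by (intro rho_detour)
  also have "\<dots> \<le> ?m"
    using cost_bounds by (intro max.mono)
  finally have "\<rho> q q' \<le> ?m" .
  moreover have "\<rho> q' r \<le> ?m" "\<rho> p q \<le> ?m"
    using cost_bounds by (auto intro: max.coboundedI1 max.coboundedI2)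
  ultimately have "max (\<rho> p q) (max (\<rho> q q') (\<rho> q' r)) \<le> ?m"
    by (intro max.boundedI)
  moreover have "\<rho> p r \<le> max (\<rho> p q) (max (\<rho> q q') (\<rho> q' r))"
    using sub.ultra_triangle[of p q r] sub.ultra_triangle[of q q' r] assms by linarith
  ultimately have "\<rho> p r \<le> ?m"
    by linarith
  moreover have "2 * D * d y p \<le> ?m" "2 * D * d r w \<le> ?m"
    using cost_bounds by (auto intro: max.coboundedI1 max.coboundedI2)
  ultimately have "max (2 * D * d y p) (max (\<rho> p r) (2 * D * d r w)) \<le> ?m"
    by (intro max.boundedI)
  then show ?thesis
    by (simp only: cost_def prod.case)
qed

lemma ext_nonneg: "0 \<le> ext y z"
  using le_extI[of y z 0] cost_nonneg by (cases "y = z") (auto simp: ext_def)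

lemma cost_commute: "cost y z (p, q) = cost z y (q, p)"
  by (simp add: cost_def amb.commute sub.commute max.left_commute max.commute)

lemma ext_commute: "ext y z = ext z y"
proof -
  have le: "ext y z \<le> ext z y" for y z
  proof (cases "y = z")
    case False
    then have "ext y z \<le> cost z y (p, q)" if "p \<in> S" "q \<in> S" for p q
      using ext_le_cost[of y z q p] that cost_commute[of z y p q] by simp
    then show ?thesis
      using False by (intro le_extI) auto
  qed simp
  show ?thesis
    by (intro antisym le)
qed

lemma ext_lower:
  assumes "y \<in> X" "z \<in> X"
  shows "2 * D / (2 * (D + 1)) * d y z \<le> ext y z"
proof (cases "y = z")
  case True
  then show ?thesis
    using assms by (simp add: ext_def)
next
  case False
  then show ?thesis
  proof (rule le_extI)
    fix p q assume pq: "p \<in> S" "q \<in> S"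
    let ?m = "cost y z (p, q)"
    have "d y z \<le> d y p + d p q + d q z"
      using amb.triangle[of y p z] amb.triangle[of p q z] assms pq S_subset by force
    then have "D * d y z \<le> D * (d y p + \<rho> p q + d q z)"
      using D_ge_1 d_le_rho[OF pq] by (intro mult_left_mono) auto
    also have "\<dots> = D * d y p + D * \<rho> p q + D * d q z"
      by (simp add: algebra_simps)
    also have "\<dots> \<le> ?m / 2 + D * ?m + ?m / 2"
      using D_ge_1 cost_bounds[of y p z q] cost_bounds(2)[of p q y z] cost_bounds(3)[of q z y p]
      by (intro add_mono mult_left_mono) auto
    also have "\<dots> = (D + 1) * ?m"
      by (simp add: algebra_simps)
    finally show "2 * D / (2 * (D + 1)) * d y z \<le> ?m"
      using D_ge_1 by (simp add: field_simps)
  qed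
qed

lemma ext_lower_from_S:
  assumes "x \<in> S" "z \<in> X"
  shows "2 * D / (2 * D + 1) * d x z \<le> ext x z"
proof (cases "x = z")
  case True
  then show ?thesis
    using assms by (simp add: ext_def)
next
  case False
  then show ?thesis
  proof (rule le_extI)
    fix p q assume pq: "p \<in> S" "q \<in> S"
    let ?m = "cost x z (p, q)"
    have "d x z \<le> d x q + d q z"
      using amb.triangle[of x q z] assms pq S_subset by force
    also have "\<dots> \<le> ?m + d q z"
      using d_le_rho[OF assms(1) pq(2)] rho_le_cost[OF assms(1) pq, of z] by linarith
    finally have "2 * D * d x z \<le> 2 * D * (?m + d q z)"
      using D_ge_1 by (intro mult_left_mono) auto
    also have "\<dots> = 2 * D * ?m + 2 * D * d q z"
      by (simp add: algebra_simps)
    also have "\<dots> \<le> (2 * D + 1) * ?m"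
      using cost_bounds(3)[of q z x p] by (simp add: algebra_simps)
    finally show "2 * D / (2 * D + 1) * d x z \<le> ?m"
      using D_ge_1 by (simp add: field_simps)
  qed
qed

lemma ext_upper_from_S:
  assumes "x \<in> S" "z \<in> X"
  shows "ext x z \<le> 2 * D * d x z"
proof (cases "x = z")
  case False
  then have "ext x z \<le> cost x z (x, x)"
    using assms by (intro ext_le_cost)
  also have "\<dots> = 2 * D * d x z"
    using assms S_subset D_ge_1 by (auto simp: cost_def)
  finally show ?thesis .
qed (use D_ge_1 in \<open>simp add: ext_def\<close>)

lemma ext_eq_rho:
  assumes "x \<in> S" "y \<in> S"
  shows "ext x y = \<rho> x y"
proof (cases "x = y")
  case False
  show ?thesis
  proof (rule antisym)
    have "ext x y \<le> cost x y (x, y)"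
      using False assms by (rule ext_le_cost)
    also have "\<dots> = \<rho> x y"
      using assms S_subset sub.nonneg[of x y] by (auto simp: cost_def subset_iff)
    finally show "ext x y \<le> \<rho> x y" .
    show "\<rho> x y \<le> ext x y"
      using False
    proof (rule le_extI)
      fix p q assume pq: "p \<in> S" "q \<in> S"
      show "\<rho> x y \<le> cost x y (p, q)"
        using sub.ultra_triangle[OF assms(1) pq(2) assms(2)] rho_le_cost[OF assms(1) pq, of y]
          rho_le_outer[OF pq(2) assms(2)] cost_bounds(3)[of q y x p] by linarith
    qed
  qed
qed (use assms in \<open>simp add: ext_def\<close>)

lemma ext_ultra_triangle:
  assumes "z \<in> X"
  shows "ext y w \<le> max (ext y z) (ext z w)"
proof (cases "y = z \<or> z = w \<or> y = w")
  case True
  moreover have "ext y y = 0"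
    by (simp add: ext_def)
  ultimately show ?thesis
    using ext_nonneg[of y z] by auto
next
  case False
  show ?thesis
  proof (rule dense_ge)
    fix c assume "max (ext y z) (ext z w) < c"
    then have lt: "ext y z < c" "ext z w < c"
      by auto
    obtain p q where pq: "p \<in> S" "q \<in> S" "cost y z (p, q) < c"
      using cost_near_ext[OF _ lt(1)] False by blast
    obtain q' r where qr: "q' \<in> S" "r \<in> S" "cost z w (q', r) < c"
      using cost_near_ext[OF _ lt(2)] False by blast
    have "ext y w \<le> cost y w (p, r)"
      using False pq qr by (intro ext_le_cost) auto
    also have "\<dots> \<le> max (cost y z (p, q)) (cost z w (q', r))"
      using pq qr assms by (intro cost_concat)
    finally show "ext y w \<le> c"
      using pq qr by linarith
  qed
qed

lemma Ultrametric_space_ext: "Ultrametric_space X ext"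
proof
  fix x y assume xy: "x \<in> X" "y \<in> X"
  have "x = y" if "ext x y = 0"
  proof -
    have "2 * D / (2 * (D + 1)) * d x y \<le> 0"
      using ext_lower[OF xy] that by simp
    moreover have "0 < 2 * D / (2 * (D + 1))"
      using D_ge_1 by simp
    ultimately have "d x y \<le> 0"
      by (simp only: mult_le_0_iff) auto
    then show ?thesis
      using xy amb.zero amb.nonneg[of x y] by force
  qed
  moreover have "ext x x = 0"
    by (simp add: ext_def)
  ultimately show "ext x y = 0 \<longleftrightarrow> x = y"
    by blast
next
  fix x y z assume "x \<in> X" "y \<in> X" "z \<in> X"
  then show "ext x z \<le> ext x y + ext y z"
    using ext_ultra_triangle[of y x z] ext_nonneg[of x y] ext_nonneg[of y z] by linarith
qed (rule ext_nonneg ext_commute ext_ultra_triangle; assumption)+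

text \<open>The two bounds on \<open>S \<times> X\<close> differ by the factor \<open>2 * D + 1\<close>; rescaling by
  \<open>(2 * D + 1) / (2 * D)\<close> turns the lower one into \<open>d\<close> itself.\<close>

lemma ext_approximates: "ultrametric_approximates (2 * D + 1) ext d S X"
  unfolding ultrametric_approximates_def
proof (intro conjI Ultrametric_space_ext exI ballI)
  let ?c = "(2 * D + 1) / (2 * D)"
  show c: "?c > 0"
    using D_ge_1 by simp
  fix x y assume xy: "x \<in> S" "y \<in> X"
  show "d x y \<le> ?c * ext x y"
    using ext_lower_from_S[OF xy] D_ge_1 by (simp add: field_simps)
  have "?c * ext x y \<le> ?c * (2 * D * d x y)"
    using ext_upper_from_S[OF xy] c by (intro mult_left_mono) auto
  then show "?c * ext x y \<le> (2 * D + 1) * d x y"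
    using D_ge_1 by simp
qed

end

theorem mainTheorem1:
  fixes X S :: "'a set" and d \<rho> :: "'a \<Rightarrow> 'a \<Rightarrow> real" and D :: real
  assumes "Metric_space X d"
    and "locally_compact_space (Metric_space.mtopology X d)"
    and "closedin (Metric_space.mtopology X d) S"
    and "D \<ge> 1"
    and "Ultrametric_space S \<rho>"
    and "\<forall>x\<in>S. \<forall>y\<in>S. d x y \<le> \<rho> x y \<and> \<rho> x y \<le> D * d x y"
  shows "\<exists>\<rho>' :: 'a \<Rightarrow> 'a \<Rightarrow> real.
           Ultrametric_space X \<rho>' \<and>
           (\<forall>x\<in>S. \<forall>y\<in>S. \<rho>' x y = \<rho> x y) \<and>
           (\<forall>x\<in>X. \<forall>y\<in>X. 2 * D / (2 * (D + 1)) * d x y \<le> \<rho>' x y) \<and>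
           (\<forall>x\<in>S. \<forall>y\<in>X. 2 * D / (2 * D + 1) * d x y \<le> \<rho>' x y \<and> \<rho>' x y \<le> 2 * D * d x y) \<and>
           ultrametric_approximates (2 * D + 1) \<rho>' d S X"
proof -
  interpret amb: Metric_space X d
    by fact
  have SX: "S \<subseteq> X"
    using assms(3) closedin_subset by fastforce
  consider "S \<noteq> {}" | a where "S = {}" "a \<in> X" | "S = {}" "X = {}"
    by blast
  then show ?thesis
  proof cases
    case 1
    interpret sub: Ultrametric_space S \<rho>
      by fact
    interpret E: ultrametric_extension X S d \<rho> D
      using assms(4,6) SX 1 by unfold_locales auto
    show ?thesis
      using E.Ultrametric_space_ext E.ext_eq_rho E.ext_lower E.ext_lower_from_S E.ext_upper_from_S
        E.ext_approximates by (intro exI[of _ E.ext]) auto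
  next
    case 2
    \<comment> \<open>Any base point will do: an ultrametric bounded below by a multiple of \<open>d\<close> is all that is left to find.\<close>
    interpret E: ultrametric_extension X "{a}" d d D
      using assms(4) 2 by unfold_locales (auto simp: amb.commute)
    show ?thesis
      using E.Ultrametric_space_ext E.ext_lower 2
      by (intro exI[of _ E.ext]) (auto simp: ultrametric_approximates_def intro: exI[of _ 1])
  next
    case 3
    have "Ultrametric_space X d"
      using 3 by unfold_locales auto
    then show ?thesis
      using 3 by (intro exI[of _ d]) (auto simp: ultrametric_approximates_def intro: exI[of _ 1])
  qed
qed

end
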